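(* Let $\mu$ be a Borel measure on $\mathbb{R}^d$. Suppose that $\mu$ is a frame spectral measure with frame spectrum $\Lambda\subset\mathbb{R}^d$. Then $$\dim \Lambda\le \inf_{K}\ \overline{\dim}_e\, \mu_K,$$ where the infimum is over all Borel sets $K\subset\mathbb{R}^d$ with $\mu(K)>0$ and $\mu(\partial K)=0$, $\mu_K$ is the restriction of $\mu$ to $K$, $\dim\Lambda$ is the (upper) Beurling dimension of $\Lambda$, and $\overline{\dim}_e$ is the upper entropy dimension.
   Context: Frame spectral measure: a nonzero finite Borel measure $\mu$ on $\mathbb{R}^d$ is a frame spectral measure with frame spectrum $\Lambda$, where $\Lambda\subset\mathbb{R}^d$ is countable, if there are constants $0<A\le B<\infty$ (frame bounds) such that for every $f\in L^2(\mu)$, $A\|f\|_{L^2(\mu)}^2\le \sum_{\lambda\in\Lambda}\left|\int f(x)e^{-2\pi i\lambda\cdot x}\,d\mu(x)\right|^2\le B\|f\|_{L^2(\mu)}^2$. Restriction: $\mu_K(\cdot)=\mu(\cdot\cap K)$; $\partial K$ is the topological boundary of $K$. Beurling dimension: for $r>0$ put $\mathfrak{D}_r^+(\Lambda)=\limsup_{h\to\infty}\sup_{x\in\mathbb{R}^d}\frac{\#(\Lambda\cap B(x,h))}{h^r}$, where $B(x,h)$ is the open ball of radius $h$ centered at $x$. Then $\dim\Lambda=\sup\{r>0:\mathfrak{D}_r^+(\Lambda)>0\}$ (with $\sup\emptyset=0$), or equivalently $\dim\Lambda=\inf\{r>0:\mathfrak{D}_r^+(\Lambda)<+\infty\}$.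 Entropy dimension: $\mathcal{D}_n$ is the partition of $\mathbb{R}^d$ into the dyadic cubes $\prod_{j=1}^d\left[\frac{k_j}{2^n},\frac{k_j+1}{2^n}\right)$, $k_j\in\mathbb{Z}$. For a probability measure $\mu$, $H(\mu,\mathcal{D}_n)=\sum_{D\in\mathcal{D}_n}-\mu(D)\log_2\mu(D)\in[0,\infty]$ (with $0\log 0=0$) and $\overline{\dim}_e\,\mu=\limsup_{n\to\infty}\frac1n H(\mu,\mathcal{D}_n)$. For a nonzero finite measure $\mu$ (such as $\mu_K$), $\overline{\dim}_e\,\mu$ means the upper entropy dimension of the normalized probability measure $\mu/\mu(\mathbb{R}^d)$. *)

theory Defs
  imports "HOL-Analysis.Analysis"
begin

definition square_integrable :: "(real^'d) measure \<Rightarrow> (real^'d \<Rightarrow> complex) \<Rightarrow> bool" where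
  "square_integrable \<mu> f \<longleftrightarrow>
     f \<in> borel_measurable \<mu> \<and> integrable \<mu> (\<lambda>x. (norm (f x))\<^sup>2)"

definition fourier_coeff ::
    "(real^'d) measure \<Rightarrow> (real^'d \<Rightarrow> complex) \<Rightarrow> real^'d \<Rightarrow> complex" where
  "fourier_coeff \<mu> f l =
     (LINT x|\<mu>. f x * exp (- 2 * complex_of_real pi * \<i> * complex_of_real (l \<bullet> x)))"

text \<open>The middle sum is taken in \<open>[0, \<infinity>]\<close>, where every sum of nonnegative terms exists; its
  finiteness is part of the upper frame bound.\<close>

definition frame_spectral_measure :: "(real^'d) measure \<Rightarrow> (real^'d) set \<Rightarrow> bool" where
  "frame_spectral_measure \<mu> \<Lambda> \<longleftrightarrow>
     finite_measure \<mu> \<and> sets \<mu> = sets borel \<and> emeasure \<mu> (space \<mu>) \<noteq> 0 \<and> countable \<Lambda> \<and>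
     (\<exists>A B :: real. 0 < A \<and> A \<le> B \<and>
       (\<forall>f. square_integrable \<mu> f \<longrightarrow>
          ennreal (A * (LINT x|\<mu>. (norm (f x))\<^sup>2))
            \<le> (\<Sum>\<^sub>\<infinity>l\<in>\<Lambda>. ennreal ((norm (fourier_coeff \<mu> f l))\<^sup>2)) \<and>
          (\<Sum>\<^sub>\<infinity>l\<in>\<Lambda>. ennreal ((norm (fourier_coeff \<mu> f l))\<^sup>2))
            \<le> ennreal (B * (LINT x|\<mu>. (norm (f x))\<^sup>2))))"

text \<open>Cardinalities are counted with \<^term>\<open>count_space UNIV\<close> rather than \<^const>\<open>card\<close>, so that an
  infinite set of points in a ball counts as \<open>\<infinity>\<close> and not as \<open>0\<close>.\<close>

definition upper_beurling_density :: "real \<Rightarrow> (real^'d) set \<Rightarrow> ennreal" where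
  "upper_beurling_density r \<Lambda> =
     Limsup at_top (\<lambda>h::real.
       SUP x. emeasure (count_space UNIV) (\<Lambda> \<inter> ball x h) / ennreal (h powr r))"

text \<open>The supremum of the empty set in \<^typ>\<open>ennreal\<close> is \<open>0\<close>, as required.\<close>

definition beurling_dim :: "(real^'d) set \<Rightarrow> ennreal" where
  "beurling_dim \<Lambda> = (SUP r\<in>{r::real. 0 < r \<and> 0 < upper_beurling_density r \<Lambda>}. ennreal r)"

definition dyadic_cube :: "nat \<Rightarrow> int^'d \<Rightarrow> (real^'d) set" where
  "dyadic_cube n k =
     {x. \<forall>j. real_of_int (k $ j) / 2 ^ n \<le> x $ j \<and> x $ j < (real_of_int (k $ j) + 1) / 2 ^ n}"

definition dyadic_partition :: "nat \<Rightarrow> (real^'d) set set" where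
  "dyadic_partition n = range (dyadic_cube n)"

text \<open>Meaningful for probability measures only: there every summand is nonnegative, so that
  \<^const>\<open>ennreal\<close> does not truncate. The convention \<open>0 log 0 = 0\<close> holds automatically.\<close>

definition partition_entropy :: "(real^'d) measure \<Rightarrow> (real^'d) set set \<Rightarrow> ennreal" where
  "partition_entropy \<mu> P = (\<Sum>\<^sub>\<infinity>D\<in>P. ennreal (- (measure \<mu> D * log 2 (measure \<mu> D))))"

definition normalized_measure :: "'a measure \<Rightarrow> 'a measure" where
  "normalized_measure \<mu> = scale_measure (1 / emeasure \<mu> (space \<mu>)) \<mu>"

text \<open>For a probability measure the normalization is the identity.\<close>

definition upper_entropy_dim :: "(real^'d) measure \<Rightarrow> ennreal" where
  "upper_entropy_dim \<mu> =
     limsup (\<lambda>n. partition_entropy (normalized_measure \<mu>) (dyadic_partition n) / of_nat n)"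

text \<open>Unlike \<^const>\<open>restrict_space\<close>, this keeps the underlying space.\<close>

definition restricted_measure :: "'a measure \<Rightarrow> 'a set \<Rightarrow> 'a measure" where
  "restricted_measure \<mu> K = density \<mu> (indicator K)"

lemma emeasure_restricted_measure:
  "K \<in> sets \<mu> \<Longrightarrow> E \<in> sets \<mu> \<Longrightarrow> emeasure (restricted_measure \<mu> K) E = emeasure \<mu> (E \<inter> K)"
  by (simp add: restricted_measure_def emeasure_restricted Int_commute)


end

theory Submission
  imports Defs "HOL-Probability.Probability_Measure"
begin

text \<open>Only the upper frame bound \<open>B\<close> matters. If \<open>D\<close> is a dyadic cube of level \<open>n\<close>, the inequality for
  a modulated indicator of \<open>D \<inter> K\<close> bounds the number of points of \<open>\<Lambda>\<close> in any ball of radius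
  \<open>2 ^ n / (6 d)\<close> by \<open>4 B / \<mu> (D \<inter> K)\<close>. Taking the heaviest cube turns this into
  \<open>log 2 #(\<Lambda> \<inter> ball) \<le> H + const\<close>, since the entropy \<open>H\<close> of the normalized \<open>\<mu>\<^sub>K\<close> is at least its
  min-entropy \<open>- log 2 (max \<mu>\<^sub>K(D))\<close>. Letting \<open>n \<rightarrow> \<infinity>\<close> compares the growth rates.\<close>

section \<open>Entropy of countable partitions\<close>

lemma emeasure_Union_le_infsum:
  assumes "countable P" "P \<subseteq> sets M"
  shows "emeasure M (\<Union>P) \<le> (\<Sum>\<^sub>\<infinity>D\<in>P. emeasure M D)"
proof (cases "P = {}")
  case False
  \<comment> \<open>The finite stages of an enumeration of \<open>P\<close>. For finite
    \<open>P\<close> the enumeration repeats members, but its images are sets, so no member is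
    counted twice.\<close>
  define F where "F n = from_nat_into P ` {..<n}" for n :: nat
  have F: "finite (F n)" "F n \<subseteq> P" for n
    using from_nat_into[OF False] by (auto simp: F_def)
  have "P = (\<Union>n. F n)"
    using range_from_nat_into[OF False \<open>countable P\<close>] by (simp add: F_def UN_lessThan_UNIV flip: image_UN)
  then have "\<Union>P = (\<Union>n. \<Union>(F n))"
    by auto
  moreover have "incseq (\<lambda>n. \<Union>(F n))"
    unfolding incseq_def F_def by (intro allI impI Union_mono image_mono) auto
  moreover have "\<Union>(F n) \<in> sets M" for n
    using F assms(2) by (intro sets.finite_Union) auto
  ultimately have "emeasure M (\<Union>P) = (SUP n. emeasure M (\<Union>(F n)))"
    by (subst SUP_emeasure_incseq) auto
  also have "\<dots> \<le> (\<Sum>\<^sub>\<infinity>D\<in>P. emeasure M D)"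
  proof (rule SUP_least)
    fix n
    have "emeasure M (\<Union>D\<in>F n. D) \<le> (\<Sum>D\<in>F n. emeasure M D)"
      using F assms(2) by (intro emeasure_subadditive_finite) auto
    also have "\<dots> = (\<Sum>\<^sub>\<infinity>D\<in>F n. emeasure M D)"
      using F by simp
    also have "\<dots> \<le> (\<Sum>\<^sub>\<infinity>D\<in>P. emeasure M D)"
      using F by (intro infsum_mono_neutral nonneg_summable_on_complete) auto
    finally show "emeasure M (\<Union>(F n)) \<le> (\<Sum>\<^sub>\<infinity>D\<in>P. emeasure M D)"
      by simp
  qed
  finally show ?thesis .
qed simp

text \<open>Since \<open>measure \<nu> D \<le> p\<close>, the summand at \<open>D\<close> is at
  least \<open>measure \<nu> D\<close> times \<open>- log 2 p\<close>, and the masses of a cover add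
  up to at least 1. For \<open>p > 1\<close> the left side is truncated to 0.\<close>

lemma partition_entropy_ge_min_entropy:
  assumes "prob_space \<nu>" "countable P" "P \<subseteq> sets \<nu>" "\<Union>P = space \<nu>"
    and p: "\<And>D. D \<in> P \<Longrightarrow> measure \<nu> D \<le> p"
  shows "ennreal (- log 2 p) \<le> partition_entropy \<nu> P"
proof -
  interpret prob_space \<nu> by fact
  define c where "c = ennreal (- log 2 p)"
  \<comment> \<open>Absorbing the constant \<open>c\<close> into the measure lets subadditivity
    apply directly, with no factor to pull out of the infinite sum.\<close>
  have "c = emeasure (scale_measure c \<nu>) (\<Union>P)"
    using assms(4) by (simp add: emeasure_space_1)
  also have "\<dots> \<le> (\<Sum>\<^sub>\<infinity>D\<in>P. emeasure (scale_measure c \<nu>) D)"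
    using assms(2,3) by (intro emeasure_Union_le_infsum) auto
  also have "\<dots> \<le> partition_entropy \<nu> P"
    unfolding partition_entropy_def
  proof (rule infsum_mono)
    fix D assume "D \<in> P"
    show "emeasure (scale_measure c \<nu>) D \<le> ennreal (- (measure \<nu> D * log 2 (measure \<nu> D)))"
    proof (cases "measure \<nu> D = 0")
      case False
      then have pos: "0 < measure \<nu> D"
        by (simp add: zero_less_measure_iff)
      with p[OF \<open>D \<in> P\<close>] have "log 2 (measure \<nu> D) \<le> log 2 p"
        by simp
      then have "measure \<nu> D * log 2 (measure \<nu> D) \<le> measure \<nu> D * log 2 p"
        by (rule mult_left_mono) simp
      moreover have "emeasure (scale_measure c \<nu>) D = ennreal (- log 2 p * measure \<nu> D)"
        by (simp add: c_def emeasure_eq_measure flip: ennreal_mult'')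
      ultimately show ?thesis
        by (auto intro!: ennreal_leI simp: mult.commute)
    qed (simp add: emeasure_eq_measure)
  qed (auto intro: nonneg_summable_on_complete)
  finally show ?thesis
    by (simp add: c_def)
qed

section \<open>Geometry of the dyadic cubes\<close>

lemma countable_dyadic_partition: "countable (dyadic_partition n :: (real^'d) set set)"
  by (simp add: dyadic_partition_def)

lemma dyadic_partition_borel:
  fixes D :: "(real^'d) set"
  assumes "D \<in> dyadic_partition n"
  shows "D \<in> sets borel"
proof -
  have "{x::real^'d. \<forall>j. a j \<le> x $ j \<and> x $ j < b j} \<in> sets borel" for a b
  proof -
    have "{x::real^'d. \<forall>j. a j \<le> x $ j \<and> x $ j < b j} = (\<Inter>j. {x. a j \<le> x $ j} \<inter> {x. x $ j < b j})"
      by auto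
    also have "\<dots> \<in> sets borel"
      by (intro sets.finite_INT sets.Int borel_closed borel_open)
        (auto intro!: closed_Collect_le open_Collect_less continuous_intros)
    finally show ?thesis .
  qed
  with assms show ?thesis
    by (auto simp: dyadic_partition_def dyadic_cube_def)
qed

lemma Union_dyadic_partition: "\<Union>(dyadic_partition n) = (UNIV :: (real^'d) set)"
proof -
  have "x \<in> dyadic_cube n (\<chi> j. \<lfloor>x $ j * 2 ^ n\<rfloor>)" for x :: "real^'d"
    using real_of_int_floor_add_one_gt by (auto simp: dyadic_cube_def field_simps)
  then show ?thesis
    by (auto simp: dyadic_partition_def)
qed

text \<open>The point \<open>a\<close> is the lower corner of the cube. Bounding the Euclidean norm
  by the l1 norm gives the factor d instead of sqrt d; the loss is a constant, which does not affect
  growth exponents.\<close>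

lemma dyadic_partition_radius:
  fixes D :: "(real^'d) set"
  assumes "D \<in> dyadic_partition n"
  obtains a where "\<And>y. y \<in> D \<Longrightarrow> norm (y - a) \<le> real CARD('d) / 2 ^ n"
proof -
  obtain k where D: "D = dyadic_cube n k"
    using assms by (auto simp: dyadic_partition_def)
  define a :: "real^'d" where "a = (\<chi> j. real_of_int (k $ j) / 2 ^ n)"
  have "norm (y - a) \<le> real CARD('d) / 2 ^ n" if "y \<in> D" for y
  proof -
    have "\<bar>(y - a) $ j\<bar> \<le> 1 / 2 ^ n" for j
      using that by (auto simp: D dyadic_cube_def a_def abs_le_iff add_divide_distrib less_imp_le
          algebra_simps dest!: spec[of _ j])
    then have "(\<Sum>j\<in>UNIV. \<bar>(y - a) $ j\<bar>) \<le> (\<Sum>j\<in>(UNIV::'d set). 1 / 2 ^ n)"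
      by (intro sum_mono) auto
    with norm_le_l1_cart[of "y - a"] show ?thesis
      by simp
  qed
  then show thesis
    by (rule that)
qed

section \<open>Counting frequencies by the Bessel inequality\<close>

lemma cos_ge_half:
  assumes "\<bar>t\<bar> \<le> 1 / 6"
  shows "1 / 2 \<le> cos (2 * pi * t)"
proof -
  \<comment> \<open>One sixth of a period is the angle pi/3, where the cosine has decreased to 1/2.
    This is the origin of the 6 in the ball radius used later.\<close>
  have "2 * pi * \<bar>t\<bar> \<le> pi / 3"
    using assms mult_left_mono[of "\<bar>t\<bar>" "1 / 6" "2 * pi"] by simp
  then have "cos (pi / 3) \<le> cos (2 * pi * \<bar>t\<bar>)"
    by (intro cos_monotone_0_pi_le) auto
  also have "cos (2 * pi * \<bar>t\<bar>) = cos (2 * pi * t)"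
    by (cases "t \<ge> 0") auto
  finally show ?thesis
    by (simp add: cos_60)
qed

definition bessel_bound :: "(real^'d) measure \<Rightarrow> (real^'d) set \<Rightarrow> real \<Rightarrow> bool" where
  "bessel_bound \<mu> \<Lambda> B \<longleftrightarrow> (\<forall>f. square_integrable \<mu> f \<longrightarrow>
     (\<Sum>\<^sub>\<infinity>l\<in>\<Lambda>. ennreal ((norm (fourier_coeff \<mu> f l))\<^sup>2)) \<le> ennreal (B * (LINT x|\<mu>. (norm (f x))\<^sup>2)))"

text \<open>Testing the Bessel inequality on the modulated indicator of \<open>E\<close>: no cancellation occurs in
  its coefficients at frequencies \<open>l\<close> for which \<open>l - x\<close> is nearly constant on \<open>E\<close>.\<close>

lemma bessel_card_le:
  fixes \<mu> :: "(real^'d) measure"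
  assumes "finite_measure \<mu>" and sets: "sets \<mu> = sets borel" and "0 \<le> B" "bessel_bound \<mu> \<Lambda> B"
    and E: "E \<in> sets borel" and S: "finite S" "S \<subseteq> \<Lambda>"
    and phase: "\<And>l y. l \<in> S \<Longrightarrow> y \<in> E \<Longrightarrow> \<bar>(l - x) \<bullet> (y - a)\<bar> \<le> 1 / 6"
  shows "real (card S) * measure \<mu> E \<le> 4 * B"
proof (cases "measure \<mu> E = 0")
  case False
  interpret finite_measure \<mu> by fact
  have meas[measurable]: "E \<in> sets \<mu>" and [measurable_cong]: "sets \<mu> = sets borel"
    using E sets by auto
  define m where "m = measure \<mu> E"
  have "0 < m"
    using False by (simp add: m_def zero_less_measure_iff)
  \<comment> \<open>Modulation by \<open>x\<close> translates frequencies: the coefficient of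
    \<open>f\<close> at \<open>l\<close> is that of the plain indicator at
    \<open>l - x\<close>.\<close>
  define f :: "real^'d \<Rightarrow> complex" where "f y = indicator E y * cis (2 * pi * (x \<bullet> y))" for y
  have cis[measurable]: "(\<lambda>y. cis (g y)) \<in> borel_measurable \<mu>" if "continuous_on UNIV g" for g :: "real^'d \<Rightarrow> real"
    unfolding cis_conv_exp using that
    by (subst measurable_cong_sets[OF sets refl]) (intro borel_measurable_continuous_onI continuous_intros)
  have norm_f: "(norm (f y))\<^sup>2 = indicator E y" for y
    by (auto simp: f_def norm_mult indicator_def)
  have f[measurable]: "f \<in> borel_measurable \<mu>"
    unfolding f_def by (intro borel_measurable_times cis borel_measurable_indicator meas continuous_intros)
  have sq: "square_integrable \<mu> f"
    unfolding square_integrable_def norm_f using f by (auto simp: less_top[symmetric])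
  have coeff: "m / 2 \<le> norm (fourier_coeff \<mu> f l)" if "l \<in> S" for l
  proof -
    define t where "t y = (l - x) \<bullet> (y - a)" for y
    define g where "g y = indicator E y * cis (- 2 * pi * t y)" for y
    have g: "integrable \<mu> g"
    proof (rule Bochner_Integration.integrable_bound[where f = "indicator E :: _ \<Rightarrow> real"])
      show "g \<in> borel_measurable \<mu>"
        unfolding g_def t_def
        by (intro borel_measurable_times cis borel_measurable_indicator meas continuous_intros)
    qed (auto simp: g_def norm_mult indicator_def less_top[symmetric])
    \<comment> \<open>Multiplying by a unimodular constant recentres the phase at \<open>a\<close>
      without changing the modulus of the coefficient. On \<open>E\<close> the recentred phase is at
      most one sixth of a period, so the real part of \<open>g\<close> is at least 1/2
      there.\<close>
    have shift: "f y * exp (- 2 * complex_of_real pi * \<i> * complex_of_real (l \<bullet> y)) * cis (2 * pi * ((l - x) \<bullet> a)) = g y" for y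
    proof -
      have "exp (- 2 * complex_of_real pi * \<i> * complex_of_real (l \<bullet> y)) = cis (- 2 * pi * (l \<bullet> y))"
        by (simp add: cis_conv_exp mult_ac)
      then show ?thesis
        by (simp add: f_def g_def t_def cis_mult mult.assoc algebra_simps inner_simps)
    qed
    have "m / 2 = (LINT y|\<mu>. indicator E y * (1 / 2 :: real))"
      by (simp add: m_def)
    also have "\<dots> \<le> (LINT y|\<mu>. Re (g y))"
    proof (rule integral_mono)
      fix y
      show "indicator E y * (1 / 2) \<le> Re (g y)"
        using cos_ge_half[of "t y"] phase[OF that, of y] by (auto simp: g_def t_def indicator_def)
    qed (use g in \<open>auto simp: less_top[symmetric]\<close>)
    also have "\<dots> = Re (LINT y|\<mu>. g y)"
      using g by simp
    also have "\<dots> \<le> norm (LINT y|\<mu>. g y)"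
      by (rule complex_Re_le_cmod)
    also have "(LINT y|\<mu>. g y) = fourier_coeff \<mu> f l * cis (2 * pi * ((l - x) \<bullet> a))"
      unfolding fourier_coeff_def shift[symmetric] by (rule integral_mult_left_zero)
    finally show ?thesis
      by (simp add: norm_mult)
  qed
  \<comment> \<open>Each of the \<open>card S\<close> coefficients contributes at least
    \<open>(m / 2)\<^sup>2\<close>, while the squared norm of \<open>f\<close> is \<open>m\<close>.
    Cancelling one factor \<open>m\<close> leaves the constant \<open>4 * B\<close>.\<close>
  have "ennreal (real (card S) * (m / 2)\<^sup>2) = (\<Sum>l\<in>S. ennreal ((m / 2)\<^sup>2))"
    by (simp add: ennreal_mult ennreal_of_nat_eq_real_of_nat)
  also have "\<dots> \<le> (\<Sum>l\<in>S. ennreal ((norm (fourier_coeff \<mu> f l))\<^sup>2))"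
    using coeff \<open>0 < m\<close> by (intro sum_mono ennreal_leI power_mono) auto
  also have "\<dots> = (\<Sum>\<^sub>\<infinity>l\<in>S. ennreal ((norm (fourier_coeff \<mu> f l))\<^sup>2))"
    using S by simp
  also have "\<dots> \<le> (\<Sum>\<^sub>\<infinity>l\<in>\<Lambda>. ennreal ((norm (fourier_coeff \<mu> f l))\<^sup>2))"
    using S by (intro infsum_mono_neutral nonneg_summable_on_complete) auto
  also have "\<dots> \<le> ennreal (B * (LINT y|\<mu>. (norm (f y))\<^sup>2))"
    using \<open>bessel_bound \<mu> \<Lambda> B\<close> sq by (auto simp: bessel_bound_def)
  also have "(LINT y|\<mu>. (norm (f y))\<^sup>2) = m"
    by (simp add: norm_f m_def)
  finally have "real (card S) * (m / 2)\<^sup>2 \<le> B * m"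
    using \<open>0 \<le> B\<close> \<open>0 < m\<close> by (simp add: ennreal_le_iff)
  then have "(real (card S) * m) * m \<le> (4 * B) * m"
    by (simp add: power2_eq_square field_simps)
  then show ?thesis
    using \<open>0 < m\<close> by (simp add: m_def)
qed (use assms in simp)

section \<open>From counting to entropy of the normalized restriction\<close>

lemma
  fixes \<mu> :: "(real^'d) measure"
  assumes "finite_measure \<mu>" and sets: "sets \<mu> = sets borel"
    and K: "K \<in> sets borel" "0 < emeasure \<mu> K"
  shows prob_space_normalized_restricted: "prob_space (normalized_measure (restricted_measure \<mu> K))"
    and measure_normalized_restricted: "E \<in> sets borel \<Longrightarrow>
      measure (normalized_measure (restricted_measure \<mu> K)) E = measure \<mu> (E \<inter> K) / measure \<mu> K"
proof -
  interpret finite_measure \<mu> by fact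
  let ?\<nu> = "normalized_measure (restricted_measure \<mu> K)"
  have space: "space \<mu> = UNIV" "space (restricted_measure \<mu> K) = UNIV" "space ?\<nu> = UNIV"
    using sets_eq_imp_space_eq[OF sets]
    by (auto simp: restricted_measure_def normalized_measure_def space_scale_measure)
  have pos: "0 < measure \<mu> K"
    using K(2) by (simp add: emeasure_eq_measure)
  have UNIV: "UNIV \<in> sets \<mu>"
    using sets by simp
  have em: "emeasure ?\<nu> E = ennreal (measure \<mu> (E \<inter> K) / measure \<mu> K)" if "E \<in> sets borel" for E
    using that K UNIV sets pos
    by (simp add: normalized_measure_def space emeasure_restricted_measure emeasure_eq_measure
        divide_ennreal[symmetric] ennreal_divide_times)
  show "prob_space ?\<nu>"
    using em[of UNIV] pos by (intro prob_spaceI) (simp add: space)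
  show "measure ?\<nu> E = measure \<mu> (E \<inter> K) / measure \<mu> K" if "E \<in> sets borel"
    using em[OF that] by (simp add: measure_def)
qed

text \<open>Many frequencies in one ball force every cube to be light: \<open>bessel_card_le\<close>
  applied to \<open>D \<inter> K\<close> bounds all cube masses by the same \<open>p\<close>, and
  the min-entropy bound applies.\<close>

lemma log_card_le_entropy:
  fixes \<mu> :: "(real^'d) measure"
  assumes \<mu>: "finite_measure \<mu>" "sets \<mu> = sets borel" and B: "0 < B" "bessel_bound \<mu> \<Lambda> B"
    and K: "K \<in> sets borel" "0 < emeasure \<mu> K"
    and S: "finite S" "S \<noteq> {}" "S \<subseteq> \<Lambda> \<inter> ball x (2 ^ n / (6 * real CARD('d)))"
  shows "ennreal (log 2 (real (card S) * measure \<mu> K / (4 * B)))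
    \<le> partition_entropy (normalized_measure (restricted_measure \<mu> K)) (dyadic_partition n)"
proof -
  interpret finite_measure \<mu> by fact
  let ?\<nu> = "normalized_measure (restricted_measure \<mu> K)"
  have sets_\<nu>: "sets ?\<nu> = sets borel"
    using \<mu> by (simp add: normalized_measure_def restricted_measure_def)
  define p where "p = 4 * B / (real (card S) * measure \<mu> K)"
  have pos: "0 < measure \<mu> K" "0 < real (card S)"
    using K(2) S by (auto simp: emeasure_eq_measure card_gt_0_iff)
  have "measure ?\<nu> D \<le> p" if D: "D \<in> dyadic_partition n" for D
  proof -
    obtain a where a: "\<And>y. y \<in> D \<Longrightarrow> norm (y - a) \<le> real CARD('d) / 2 ^ n"
      using dyadic_partition_radius[OF D] by blast
    have "real (card S) * measure \<mu> (D \<inter> K) \<le> 4 * B"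
    proof (rule bessel_card_le[OF \<mu> _ B(2)])
      fix l y assume "l \<in> S" "y \<in> D \<inter> K"
      then have "norm (l - x) \<le> 2 ^ n / (6 * real CARD('d))"
        using S(3) by (auto simp: dist_norm norm_minus_commute)
      \<comment> \<open>The ball radius is chosen so that its product with the cube radius is
        exactly 1/6.\<close>
      then have "norm (l - x) * norm (y - a) \<le> 2 ^ n / (6 * real CARD('d)) * (real CARD('d) / 2 ^ n)"
        using \<open>y \<in> D \<inter> K\<close> by (intro mult_mono a) auto
      with Cauchy_Schwarz_ineq2[of "l - x" "y - a"] show "\<bar>(l - x) \<bullet> (y - a)\<bar> \<le> 1 / 6"
        by simp
    qed (use S B K dyadic_partition_borel[OF D] in auto)
    then show ?thesis
      using pos measure_normalized_restricted[OF \<mu> K dyadic_partition_borel[OF D]]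
      by (simp add: p_def field_simps)
  qed
  then have "ennreal (- log 2 p) \<le> partition_entropy ?\<nu> (dyadic_partition n)"
    using dyadic_partition_borel sets_\<nu> sets_eq_imp_space_eq[OF sets_\<nu>]
    by (intro partition_entropy_ge_min_entropy prob_space_normalized_restricted[OF \<mu> K]
        countable_dyadic_partition) (auto simp: Union_dyadic_partition)
  also have "- log 2 p = log 2 (real (card S) * measure \<mu> K / (4 * B))"
    using pos B(1) by (simp add: p_def log_divide log_mult)
  finally show ?thesis .
qed

section \<open>Growth rates and Beurling density\<close>

lemma emeasure_count_space_leI:
  assumes "0 \<le> c" "\<And>S. finite S \<Longrightarrow> S \<subseteq> X \<Longrightarrow> real (card S) \<le> c"
  shows "emeasure (count_space UNIV) X \<le> ennreal c"
proof -
  \<comment> \<open>The Bessel argument only counts finite subsets, so finiteness of the whole set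
    must be derived: an infinite set would contain a finite subset with more than \<open>c\<close>
    elements.\<close>
  have "finite X"
  proof (rule ccontr)
    assume "infinite X"
    then obtain S where "S \<subseteq> X" "finite S" "card S = nat \<lceil>c\<rceil> + 1"
      using infinite_arbitrarily_large by blast
    with assms(2)[of S] show False
      by linarith
  qed
  with assms show ?thesis
    by (simp add: ennreal_of_nat_eq_real_of_nat ennreal_leI)
qed

text \<open>The quotient defining the density is at most \<open>C * h powr (s - r)\<close>,
  uniformly in the centre, and this tends to 0 because the exponent is negative.\<close>

lemma upper_beurling_density_eq_0:
  fixes \<Lambda> :: "(real^'d) set"
  assumes "s < r"
    and bound: "\<forall>\<^sub>F h in at_top. \<forall>x. emeasure (count_space UNIV) (\<Lambda> \<inter> ball x h) \<le> ennreal (C * h powr s)"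
  shows "upper_beurling_density r \<Lambda> = 0"
proof -
  have "\<forall>\<^sub>F h in at_top. (SUP x. emeasure (count_space UNIV) (\<Lambda> \<inter> ball x h) / ennreal (h powr r))
      \<le> ennreal (C * h powr (s - r))"
    using bound eventually_gt_at_top[of 0]
  proof eventually_elim
    case (elim h)
    show ?case
    proof (rule SUP_least)
      fix x
      have "emeasure (count_space UNIV) (\<Lambda> \<inter> ball x h) / ennreal (h powr r)
          \<le> ennreal (C * h powr s) / ennreal (h powr r)"
        using elim by (intro divide_right_mono_ennreal) auto
      also have "\<dots> = ennreal (C * h powr (s - r))"
        using elim by (cases "0 \<le> C")
          (auto simp: divide_ennreal powr_diff ennreal_neg mult_nonpos_nonneg divide_nonpos_nonneg)
      finally show "emeasure (count_space UNIV) (\<Lambda> \<inter> ball x h) / ennreal (h powr r)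
          \<le> ennreal (C * h powr (s - r))" .
    qed
  qed
  then have "upper_beurling_density r \<Lambda> \<le> Limsup at_top (\<lambda>h. ennreal (C * h powr (s - r)))"
    unfolding upper_beurling_density_def by (rule Limsup_mono)
  also have "((\<lambda>h. ennreal (C * h powr (s - r))) \<longlongrightarrow> ennreal (C * 0)) at_top"
    using \<open>s < r\<close> by (intro tendsto_ennrealI tendsto_intros tendsto_neg_powr filterlim_ident) auto
  then have "Limsup at_top (\<lambda>h. ennreal (C * h powr (s - r))) = 0"
    by (simp add: lim_imp_Limsup)
  finally show ?thesis
    by simp
qed

text \<open>Entropy below \<open>s * n\<close> at all large levels limits the count in balls of
  radius about \<open>2 ^ n\<close> to a multiple of \<open>2 ^ n\<close> raised to the power
  \<open>s\<close>. Rounding an arbitrary radius up to a dyadic one gives a count of order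
  \<open>h powr s\<close>.\<close>

lemma upper_beurling_density_eq_0_if_entropy_less:
  fixes \<mu> :: "(real^'d) measure"
  assumes \<mu>: "finite_measure \<mu>" "sets \<mu> = sets borel" and B: "0 < B" "bessel_bound \<mu> \<Lambda> B"
    and K: "K \<in> sets borel" "0 < emeasure \<mu> K"
    and s: "0 < s" "upper_entropy_dim (restricted_measure \<mu> K) < ennreal s" and "s < r"
  shows "upper_beurling_density r \<Lambda> = 0"
proof -
  interpret finite_measure \<mu> by fact
  let ?H = "\<lambda>n. partition_entropy (normalized_measure (restricted_measure \<mu> K)) (dyadic_partition n)"
  define d where "d = real CARD('d)"
  define b where "b = 4 * B / measure \<mu> K"
  have mK: "0 < measure \<mu> K"
    using K(2) by (simp add: emeasure_eq_measure)
  have "0 < d" "0 < b"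
    using mK B by (auto simp: d_def b_def)
  have "\<forall>\<^sub>F n in sequentially. ?H n / of_nat n < ennreal s"
    using Limsup_lessD[OF s(2)[unfolded upper_entropy_dim_def]] .
  then obtain N where N: "\<And>n. N \<le> n \<Longrightarrow> ?H n / of_nat n < ennreal s"
    by (auto simp: eventually_sequentially)
  have H: "?H n < ennreal (s * n)" if "N \<le> n" "0 < n" for n
  proof -
    have "?H n = ?H n / of_nat n * of_nat n"
      using that by (simp add: ennreal_divide_times ennreal_divide_self of_nat_less_top)
    also have "\<dots> < ennreal s * of_nat n"
      using N[OF that(1)] that(2)
      by (intro ennreal_mult_strict_right_mono) (auto simp: less_top[symmetric])
    finally show ?thesis
      using s by (simp add: ennreal_mult ennreal_of_nat_eq_real_of_nat)
  qed
  have card: "real (card S) \<le> b * (2 ^ n) powr s"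
    if n: "N \<le> n" "0 < n" and S: "finite S" "S \<subseteq> \<Lambda> \<inter> ball x (2 ^ n / (6 * d))" for n S x
  proof (cases "S = {}")
    case False
    then have "0 < real (card S) * measure \<mu> K / (4 * B)"
      using S mK B by (simp add: card_gt_0_iff)
    moreover have "ennreal (log 2 (real (card S) * measure \<mu> K / (4 * B))) < ennreal (s * n)"
      using log_card_le_entropy[OF \<mu> B K S(1) False S(2)[unfolded d_def]] H[OF n] by (rule le_less_trans)
    \<comment> \<open>\<open>ennreal\<close> may truncate a negative logarithm, but its monotonicity
      still yields the real inequality by contraposition.\<close>
    then have "log 2 (real (card S) * measure \<mu> K / (4 * B)) < s * n"
      by (meson ennreal_leI not_le)
    ultimately have "real (card S) * measure \<mu> K / (4 * B) < 2 powr (n * s)"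
      by (simp add: log_less_iff mult.commute)
    then show ?thesis
      using mK B by (simp add: b_def field_simps powr_powr flip: powr_realpow)
  qed (use \<open>0 < b\<close> in simp)
  have "\<forall>\<^sub>F h in at_top. \<forall>x. emeasure (count_space UNIV) (\<Lambda> \<inter> ball x h)
      \<le> ennreal (b * (12 * d) powr s * h powr s)"
    \<comment> \<open>Beyond this threshold \<open>log 2 (6 * d * h)\<close> is at least
      \<open>N + 1\<close>, so the level chosen below is positive and at least
      \<open>N\<close>.\<close>
    using eventually_ge_at_top[of "2 ^ (N + 1) / (6 * d)"]
  proof eventually_elim
    case (elim h)
    then have "2 ^ (N + 1) \<le> 6 * d * h"
      using \<open>0 < d\<close> by (simp add: field_simps)
    \<comment> \<open>The least level whose ball radius \<open>2 ^ n / (6 * d)\<close> reaches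
      \<open>h\<close>. Rounding up at most doubles \<open>6 * d * h\<close>, whence the constant
      \<open>12 * d\<close>.\<close>
    define n where "n = nat \<lceil>log 2 (6 * d * h)\<rceil>"
    have "0 < h"
      using elim \<open>0 < d\<close> by (smt (verit) divide_pos_pos zero_less_power)
    then have pos: "0 < 6 * d * h"
      using \<open>0 < d\<close> by simp
    have ge: "real (N + 1) \<le> log 2 (6 * d * h)"
      using \<open>2 ^ (N + 1) \<le> 6 * d * h\<close> pos by (subst le_log_iff) (simp_all add: powr_realpow flip: of_nat_Suc)
    then have n: "N \<le> n" "0 < n" "log 2 (6 * d * h) \<le> n" "n < log 2 (6 * d * h) + 1"
      unfolding n_def by linarith+
    have "6 * d * h = 2 powr log 2 (6 * d * h)"
      using pos by simp
    also have "\<dots> \<le> 2 powr n"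
      using n by (intro powr_mono) auto
    finally have "h \<le> 2 ^ n / (6 * d)"
      using \<open>0 < d\<close> by (simp add: powr_realpow field_simps)
    have "2 ^ n = 2 powr real n"
      by (simp add: powr_realpow)
    also have "\<dots> \<le> 2 powr (log 2 (6 * d * h) + 1)"
      using n by (intro powr_mono) auto
    also have "\<dots> = 12 * d * h"
      using pos by (simp add: powr_add)
    finally have "(2 ^ n) powr s \<le> (12 * d) powr s * h powr s"
      using s \<open>0 < d\<close> \<open>0 < h\<close> by (simp add: powr_mono2 flip: powr_mult)
    then have C: "b * (2 ^ n) powr s \<le> b * (12 * d) powr s * h powr s"
      using \<open>0 < b\<close> by simp
    show ?case
    proof (intro allI emeasure_count_space_leI)
      fix x S assume "finite S" "S \<subseteq> \<Lambda> \<inter> ball x h"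
      then show "real (card S) \<le> b * (12 * d) powr s * h powr s"
        using card[OF n(1,2), of S x] C \<open>h \<le> 2 ^ n / (6 * d)\<close> by force
    qed (use \<open>0 < b\<close> in simp)
  qed
  with \<open>s < r\<close> show ?thesis
    by (rule upper_beurling_density_eq_0)
qed

theorem theorem1p3:
  fixes \<mu> :: "(real^'d) measure" and \<Lambda> :: "(real^'d) set"
  assumes "frame_spectral_measure \<mu> \<Lambda>"
  shows "beurling_dim \<Lambda> \<le>
    (INF K\<in>{K. K \<in> sets borel \<and> 0 < emeasure \<mu> K \<and> emeasure \<mu> (frontier K) = 0}.
       upper_entropy_dim (restricted_measure \<mu> K))"
proof -
  obtain A B where \<mu>: "finite_measure \<mu>" "sets \<mu> = sets borel" and "0 < A" "A \<le> B" "bessel_bound \<mu> \<Lambda> B"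
    using assms unfolding frame_spectral_measure_def bessel_bound_def by metis
  then have B: "0 < B" "bessel_bound \<mu> \<Lambda> B"
    by auto
  have "ennreal r \<le> upper_entropy_dim (restricted_measure \<mu> K)"
    if K: "K \<in> sets borel" "0 < emeasure \<mu> K" and r: "0 < upper_beurling_density r \<Lambda>" for K r
  proof (rule ccontr)
    assume "\<not> ?thesis"
    then have "upper_entropy_dim (restricted_measure \<mu> K) < ennreal r"
      by simp
    \<comment> \<open>An exponent strictly between the entropy dimension and \<open>r\<close>
      supplies both strict gaps required to make the density at \<open>r\<close> vanish. It is
      finite because it lies below \<open>ennreal r\<close>, and positive because it lies above a
      nonnegative value.\<close>
    then obtain e where e: "upper_entropy_dim (restricted_measure \<mu> K) < e" "e < ennreal r"
      using dense by blast
    then obtain s where "e = ennreal s" "0 \<le> s"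
      by (cases e) auto
    moreover from this e have "0 < s" "s < r"
      by (auto simp: ennreal_less_iff intro: gr_zeroI order_le_neq_trans)
    ultimately have "upper_beurling_density r \<Lambda> = 0"
      using upper_beurling_density_eq_0_if_entropy_less[OF \<mu> B K] e by blast
    with r show False
      by simp
  qed
  then show ?thesis
    unfolding beurling_dim_def by (intro INF_greatest SUP_least) auto
qed

end
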